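(* For every compact metric space $X$, there exists an inverse sequence of finite topological spaces and continuous maps whose inverse limit has the same homotopy type as $X$.
   Context: A finite space is a topological space with finitely many points (with an arbitrary topology, not necessarily discrete or Hausdorff). An inverse sequence is a sequence of spaces $X_n$ ($n\ge 1$) with continuous maps $p_{n,n+1}:X_{n+1}\to X_n$; its inverse limit is the subspace of $\prod_n X_n$ of points $(x_n)$ with $p_{n,n+1}(x_{n+1})=x_n$ for all $n$. *)

theory Defs
  imports "HOL-Analysis.Analysis"
begin

(* Inverse sequences are indexed from 0; the bonding map p n goes from X (Suc n) to X n. *)

definition inverse_sequence :: "(nat \<Rightarrow> 'b topology) \<Rightarrow> (nat \<Rightarrow> 'b \<Rightarrow> 'b) \<Rightarrow> bool" where
  "inverse_sequence X p \<longleftrightarrow> (\<forall>n. continuous_map (X (Suc n)) (X n) (p n))"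

definition inverse_limit :: "(nat \<Rightarrow> 'b topology) \<Rightarrow> (nat \<Rightarrow> 'b \<Rightarrow> 'b) \<Rightarrow> (nat \<Rightarrow> 'b) topology" where
  "inverse_limit X p =
     subtopology (product_topology X UNIV) {x. \<forall>n. p n (x (Suc n)) = x n}"

lemma topspace_inverse_limit:
  "topspace (inverse_limit X p) =
     {x. (\<forall>n. x n \<in> topspace (X n)) \<and> (\<forall>n. p n (x (Suc n)) = x n)}"
  by (auto simp: inverse_limit_def PiE_iff)

end

theory Submission
  imports Defs "HOL-Library.Nat_Bijection"
begin

text \<open>
  Only three properties of a compact metric space matter: it is compact, Hausdorff and has a
  countable base \<open>U 0, U 1, \<dots>\<close> of open sets.

  Record for each point \<open>x\<close> which of the sets \<open>U 0, \<dots>, U (n - 1)\<close> contain it.  Only finitely many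
  such membership patterns occur.  Ordered by inclusion, and with the upward closed sets as open
  sets, they form a finite space on which the pattern is a continuous function of the point, and
  forgetting the last bit is a continuous bonding map.  A point of the inverse limit is an infinite
  pattern \<open>a\<close> each of whose initial segments \<open>a n\<close> is the pattern of some point, that is, for which
  the sets \<open>D n\<close> of points with pattern \<open>a n\<close> form a decreasing sequence of nonempty sets.

  By compactness the closures of the sets \<open>D n\<close> have a common point \<open>x\<close>.  Whenever \<open>x \<in> U i\<close>, the set
  \<open>U i\<close> meets each \<open>D n\<close>.  For \<open>n > i\<close> it is a union of pattern classes, so it then contains \<open>D n\<close>.
  Two facts follow.  As \<open>U i\<close> can be chosen with closure missing any given other
  point, \<open>x\<close> is unique, and regularity makes it depend continuously on \<open>a\<close>; call it \<open>r a\<close>.  Moreover,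
  the pattern of \<open>r a\<close> is contained in \<open>a\<close>.  Let \<open>e\<close> be the map sending a point to its infinite
  pattern.  Then \<open>r \<circ> e\<close> is the identity, and \<open>e \<circ> r\<close> lies pointwise below the identity.

  Finally, comparable maps into such a space are homotopic, through the homotopy that is the
  smaller map at time \<open>0\<close> and jumps to the larger map at all later times.
\<close>

section \<open>Homotopies along the specialization order\<close>

text \<open>
  If \<open>g x\<close> lies in every open set that contains \<open>f x\<close>, then the jump from \<open>f\<close> to \<open>g\<close> is continuous:
  the preimage of an open set \<open>W\<close> is the union of all times over the preimage under \<open>f\<close> and the
  positive times over the preimage under \<open>g\<close>.
\<close>

lemma continuous_map_specialization_jump:
  assumes f: "continuous_map X Y f" and g: "continuous_map X Y g"
    and spec: "\<And>x W. \<lbrakk>x \<in> topspace X; openin Y W; f x \<in> W\<rbrakk> \<Longrightarrow> g x \<in> W"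
  shows "continuous_map (prod_topology (top_of_set {0..1::real}) X) Y
           (\<lambda>(t, x). if t = 0 then f x else g x)"
    (is "continuous_map ?P Y ?h")
  unfolding continuous_map_def
proof (intro conjI allI impI)
  show "?h \<in> topspace ?P \<rightarrow> topspace Y"
    using f g by (auto simp: continuous_map_def)
next
  fix W assume W: "openin Y W"
  let ?F = "{x \<in> topspace X. f x \<in> W}" and ?G = "{x \<in> topspace X. g x \<in> W}"
  have "{z \<in> topspace ?P. ?h z \<in> W} = {0..1} \<times> ?F \<union> {0<..1} \<times> ?G"
    using spec[OF _ W] by (auto split: if_splits)
  moreover have "openin ?P ({0..1} \<times> ?F)"
    using f W by (simp add: openin_prod_Times_iff continuous_map_def)
  moreover have "openin ?P ({0<..1} \<times> ?G)"
  proof -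
    have "{0<..1::real} = {0..1} \<inter> {0<..}"
      by auto
    then have "openin (top_of_set {0..1}) {0<..1::real}"
      by (metis openin_open_Int open_greaterThan)
    then show ?thesis
      using g W by (simp add: openin_prod_Times_iff continuous_map_def)
  qed
  ultimately show "openin ?P {z \<in> topspace ?P. ?h z \<in> W}"
    by (simp add: openin_Un)
qed

text \<open>
  Every intermediate stage of the jump is one of the two maps, so it respects the bonding maps;
  its continuity into an inverse limit can then be tested one coordinate at a time.
\<close>

lemma homotopic_with_inverse_limit_specialization:
  assumes f: "continuous_map Z (inverse_limit X p) f"
    and g: "continuous_map Z (inverse_limit X p) g"
    and spec: "\<And>z n W. \<lbrakk>z \<in> topspace Z; openin (X n) W; f z n \<in> W\<rbrakk> \<Longrightarrow> g z n \<in> W"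
  shows "homotopic_with (\<lambda>h. True) Z (inverse_limit X p) f g"
proof -
  let ?h = "\<lambda>(t::real, z). if t = 0 then f z else g z"
  let ?P = "prod_topology (top_of_set {0..1::real}) Z"
  have "continuous_map ?P (X n) (\<lambda>y. ?h y n)" for n
  proof -
    have "continuous_map Z (X n) (\<lambda>z. f z n)" "continuous_map Z (X n) (\<lambda>z. g z n)"
      using f g
      by (simp_all add: inverse_limit_def continuous_map_in_subtopology
          continuous_map_componentwise_UNIV)
    from continuous_map_specialization_jump[OF this] spec
    have "continuous_map ?P (X n) (\<lambda>(t, z). if t = 0 then f z n else g z n)"
      by blast
    then show ?thesis
      by (simp add: case_prod_unfold if_distribR)
  qed
  moreover have "?h y \<in> {x. \<forall>n. p n (x (Suc n)) = x n}" if "y \<in> topspace ?P" for y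
  proof -
    have "f (snd y) \<in> topspace (inverse_limit X p)" "g (snd y) \<in> topspace (inverse_limit X p)"
      using f g that by (auto simp: continuous_map_def)
    then show ?thesis
      by (auto simp: topspace_inverse_limit case_prod_beta)
  qed
  ultimately have "continuous_map ?P (inverse_limit X p) ?h"
    unfolding inverse_limit_def continuous_map_in_subtopology continuous_map_componentwise_UNIV
    by blast
  then show ?thesis
    unfolding homotopic_with_def by (intro exI[of _ ?h]) auto
qed

section \<open>Finite spaces of membership patterns\<close>

text \<open>
  Finite sets of naturals are coded by their binary expansion, so that all the finite spaces have
  their points in one type.
\<close>

definition pattern :: "(nat \<Rightarrow> 'a set) \<Rightarrow> nat \<Rightarrow> 'a \<Rightarrow> nat" where
  "pattern U n x = set_encode {i. i < n \<and> x \<in> U i}"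

definition forget_last :: "nat \<Rightarrow> nat \<Rightarrow> nat" where
  "forget_last n c = set_encode (set_decode c \<inter> {..<n})"

definition upset_topology :: "nat set \<Rightarrow> nat topology" where
  "upset_topology C = topology (\<lambda>W. W \<subseteq> C \<and>
     (\<forall>a\<in>W. \<forall>b\<in>C. set_decode a \<subseteq> set_decode b \<longrightarrow> b \<in> W))"

lemma openin_upset_topology:
  "openin (upset_topology C) W \<longleftrightarrow>
     W \<subseteq> C \<and> (\<forall>a\<in>W. \<forall>b\<in>C. set_decode a \<subseteq> set_decode b \<longrightarrow> b \<in> W)"
proof -
  have "istopology (\<lambda>W. W \<subseteq> C \<and> (\<forall>a\<in>W. \<forall>b\<in>C. set_decode a \<subseteq> set_decode b \<longrightarrow> b \<in> W))"
    unfolding istopology_def by blast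
  then show ?thesis
    by (simp add: upset_topology_def)
qed

lemma topspace_upset_topology [simp]: "topspace (upset_topology C) = C"
proof
  show "topspace (upset_topology C) \<subseteq> C"
    using openin_topspace[of "upset_topology C"] unfolding openin_upset_topology by blast
  have "openin (upset_topology C) C"
    by (simp add: openin_upset_topology)
  then show "C \<subseteq> topspace (upset_topology C)"
    by (rule openin_subset)
qed

lemma set_decode_pattern [simp]: "set_decode (pattern U n x) = {i. i < n \<and> x \<in> U i}"
  by (simp add: pattern_def)

lemma set_decode_forget_last [simp]: "set_decode (forget_last n c) = set_decode c \<inter> {..<n}"
  by (simp add: forget_last_def)

lemma forget_last_pattern: "forget_last n (pattern U (Suc n) x) = pattern U n x"
  by (simp add: forget_last_def pattern_def) (rule arg_cong[where f = set_encode], auto)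

lemma finite_range_pattern: "finite (range (pattern U n))"
proof -
  have "range (pattern U n) \<subseteq> set_encode ` Pow {..<n}"
    by (auto simp: pattern_def)
  then show ?thesis
    by (rule finite_subset) simp
qed

definition pattern_space :: "'a topology \<Rightarrow> (nat \<Rightarrow> 'a set) \<Rightarrow> nat \<Rightarrow> nat topology" where
  "pattern_space T U n = upset_topology (pattern U n ` topspace T)"

lemma topspace_pattern_space [simp]:
  "topspace (pattern_space T U n) = pattern U n ` topspace T"
  by (simp add: pattern_space_def)

lemma inverse_sequence_pattern_space: "inverse_sequence (pattern_space T U) forget_last"
  unfolding inverse_sequence_def
proof
  fix n
  have "openin (pattern_space T U (Suc n))
          {c \<in> topspace (pattern_space T U (Suc n)). forget_last n c \<in> W}"
    if W: "openin (pattern_space T U n) W" for W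
    unfolding pattern_space_def openin_upset_topology
  proof (intro conjI ballI impI)
    fix a b
    assume a: "a \<in> {c \<in> topspace (upset_topology (pattern U (Suc n) ` topspace T)).
                    forget_last n c \<in> W}"
      and b: "b \<in> pattern U (Suc n) ` topspace T" and ab: "set_decode a \<subseteq> set_decode b"
    have "forget_last n b \<in> pattern U n ` topspace T"
      using b by (auto simp: forget_last_pattern)
    moreover have "set_decode (forget_last n a) \<subseteq> set_decode (forget_last n b)"
      using ab by auto
    ultimately have "forget_last n b \<in> W"
      using W a unfolding pattern_space_def openin_upset_topology by blast
    with b show "b \<in> {c \<in> topspace (upset_topology (pattern U (Suc n) ` topspace T)).
                    forget_last n c \<in> W}"
      by simp
  qed auto
  then show "continuous_map (pattern_space T U (Suc n)) (pattern_space T U n) (forget_last n)"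
    by (auto simp: continuous_map_def forget_last_pattern)
qed

text \<open>
  Near \<open>x\<close> patterns can only grow: on the intersection of the finitely many sets \<open>U i\<close> recorded in
  the pattern of \<open>x\<close>, every pattern contains that of \<open>x\<close>.
\<close>

lemma continuous_map_pattern:
  assumes U: "\<And>i. openin T (U i)"
  shows "continuous_map T (pattern_space T U n) (pattern U n)"
  unfolding continuous_map_def
proof (intro conjI allI impI)
  fix W assume W: "openin (pattern_space T U n) W"
  show "openin T {x \<in> topspace T. pattern U n x \<in> W}"
  proof (subst openin_subopen, intro ballI)
    fix x assume x: "x \<in> {x \<in> topspace T. pattern U n x \<in> W}"
    \<comment> \<open>Intersecting with the whole space covers the case that no \<open>U i\<close> with \<open>i < n\<close> contains \<open>x\<close>.\<close>
    let ?N = "\<Inter> (insert (topspace T) (U ` {i. i < n \<and> x \<in> U i}))"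
    have "openin T ?N"
      by (rule openin_Inter) (use U in auto)
    moreover have "x \<in> ?N"
      using x by auto
    moreover have "pattern U n y \<in> W" if "y \<in> ?N" for y
    proof -
      have "set_decode (pattern U n x) \<subseteq> set_decode (pattern U n y)"
        using that by auto
      moreover have "pattern U n y \<in> pattern U n ` topspace T"
        using that by auto
      ultimately show ?thesis
        using W x unfolding pattern_space_def openin_upset_topology by blast
    qed
    ultimately show "\<exists>N. openin T N \<and> x \<in> N \<and> N \<subseteq> {x \<in> topspace T. pattern U n x \<in> W}"
      by (intro exI[of _ ?N]) auto
  qed
qed auto

section \<open>Retracting the limit of patterns onto the space\<close>

locale compact_Hausdorff_base =
  fixes T :: "'a topology" and U :: "nat \<Rightarrow> 'a set"
  assumes compact: "compact_space T" and Hausdorff: "Hausdorff_space T"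
    and openin_base: "\<And>i. openin T (U i)"
    and base: "\<And>W x. \<lbrakk>openin T W; x \<in> W\<rbrakk> \<Longrightarrow> \<exists>i. x \<in> U i \<and> U i \<subseteq> W"
begin

abbreviation L :: "(nat \<Rightarrow> nat) topology" where
  "L \<equiv> inverse_limit (pattern_space T U) forget_last"

abbreviation full_pattern :: "'a \<Rightarrow> nat \<Rightarrow> nat" where
  "full_pattern x \<equiv> \<lambda>n. pattern U n x"

definition realizing_points :: "(nat \<Rightarrow> nat) \<Rightarrow> nat \<Rightarrow> 'a set" where
  "realizing_points a n = {x \<in> topspace T. pattern U n x = a n}"

definition limit_points :: "(nat \<Rightarrow> nat) \<Rightarrow> 'a set" where
  "limit_points a = (\<Inter>n. T closure_of realizing_points a n)"

lemma continuous_map_full_pattern: "continuous_map T L full_pattern"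
  unfolding inverse_limit_def continuous_map_in_subtopology continuous_map_componentwise_UNIV
  by (auto simp: continuous_map_pattern openin_base forget_last_pattern)

lemma realizing_points_nonempty:
  assumes "a \<in> topspace L"
  shows "realizing_points a n \<noteq> {}"
proof -
  have "a n \<in> pattern U n ` topspace T"
    using assms by (simp add: topspace_inverse_limit)
  then show ?thesis
    by (auto simp: realizing_points_def)
qed

lemma decseq_realizing_points:
  assumes "a \<in> topspace L"
  shows "decseq (realizing_points a)"
  unfolding decseq_Suc_iff
proof (intro allI subsetI)
  fix n x assume "x \<in> realizing_points a (Suc n)"
  moreover have "forget_last n (a (Suc n)) = a n"
    using assms by (simp add: topspace_inverse_limit)
  ultimately show "x \<in> realizing_points a n"
    using forget_last_pattern[of n U x] by (auto simp: realizing_points_def)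
qed

lemma realizing_points_bit:
  assumes "x \<in> realizing_points a n" "i < n"
  shows "x \<in> U i \<longleftrightarrow> i \<in> set_decode (a n)"
proof -
  have "set_decode (a n) = {i. i < n \<and> x \<in> U i}"
    using assms(1) set_decode_pattern[of U n x] by (simp add: realizing_points_def)
  with assms(2) show ?thesis
    by simp
qed

text \<open>
  A basic open set around a limit point meets every \<open>realizing_points a n\<close>; once \<open>i < n\<close>, all points of
  \<open>realizing_points a n\<close> agree about membership in \<open>U i\<close>.
\<close>

lemma limit_point_bit:
  assumes x: "x \<in> limit_points a" and i: "x \<in> U i" "i < n"
  shows "i \<in> set_decode (a n)"
proof -
  have "x \<in> T closure_of realizing_points a n"
    using x by (simp add: limit_points_def)
  then obtain y where "y \<in> realizing_points a n" "y \<in> U i"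
    using i(1) openin_base unfolding in_closure_of by blast
  then show ?thesis
    using realizing_points_bit i(2) by blast
qed

lemma limit_points_in_closure:
  assumes "y \<in> limit_points a" "i \<in> set_decode (a (Suc i))"
  shows "y \<in> T closure_of U i"
proof -
  have "realizing_points a (Suc i) \<subseteq> U i"
    using realizing_points_bit[of _ a "Suc i" i] assms(2) by auto
  moreover have "y \<in> T closure_of realizing_points a (Suc i)"
    using assms(1) by (simp add: limit_points_def)
  ultimately show ?thesis
    using closure_of_mono by blast
qed

lemma limit_points_nonempty:
  assumes "a \<in> topspace L"
  shows "limit_points a \<noteq> {}"
  unfolding limit_points_def
proof (rule compact_space_imp_nest[OF compact])
  show "decseq (\<lambda>n. T closure_of realizing_points a n)"
    using decseqD[OF decseq_realizing_points[OF assms]]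
    unfolding decseq_def by (intro allI impI closure_of_mono)
  show "T closure_of realizing_points a n \<noteq> {}" for n
  proof -
    have "realizing_points a n \<subseteq> topspace T"
      by (auto simp: realizing_points_def)
    then show ?thesis
      using realizing_points_nonempty[OF assms, of n] closure_of_subset[of "realizing_points a n" T]
      by blast
  qed
  show "closedin T (T closure_of realizing_points a n)" for n
    by (rule closedin_closure_of)
qed

lemma base_closure:
  assumes "openin T V" "x \<in> V"
  obtains i where "x \<in> U i" "T closure_of U i \<subseteq> V"
proof -
  have "neighbourhood_base_of (closedin T) T"
    unfolding neighbourhood_base_of_closedin
    using compact Hausdorff by (rule compact_Hausdorff_imp_regular_space)
  then obtain W K where W: "openin T W" "closedin T K" "x \<in> W" "W \<subseteq> K" "K \<subseteq> V"
    using assms unfolding neighbourhood_base_of by metis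
  obtain i where i: "x \<in> U i" "U i \<subseteq> W"
    using base W by blast
  have "T closure_of U i \<subseteq> K"
    using W i by (intro closure_of_minimal) auto
  with W i that show thesis
    by blast
qed

lemma limit_points_unique:
  assumes x: "x \<in> limit_points a" and y: "y \<in> limit_points a"
  shows "x = y"
proof (rule ccontr)
  assume "x \<noteq> y"
  have top: "x \<in> topspace T" "y \<in> topspace T"
    using x y by (auto simp: limit_points_def in_closure_of)
  have "openin T (topspace T - {y})"
    using top Hausdorff by (simp add: closedin_Hausdorff_singleton openin_diff)
  then obtain i where i: "x \<in> U i" "T closure_of U i \<subseteq> topspace T - {y}"
    using base_closure[of "topspace T - {y}" x] top \<open>x \<noteq> y\<close> by blast
  have "y \<in> T closure_of U i"
    using limit_points_in_closure[OF y] limit_point_bit[OF x i(1)] by blast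
  with i show False
    by blast
qed

definition limit_point :: "(nat \<Rightarrow> nat) \<Rightarrow> 'a" where
  "limit_point a = (SOME x. x \<in> limit_points a)"

lemma limit_point_in: "a \<in> topspace L \<Longrightarrow> limit_point a \<in> limit_points a"
  unfolding limit_point_def using limit_points_nonempty by (simp add: some_in_eq)

lemma limit_points_subset_topspace: "limit_points a \<subseteq> topspace T"
  by (auto simp: limit_points_def in_closure_of)

lemma limit_point_full_pattern:
  assumes "x \<in> topspace T"
  shows "limit_point (full_pattern x) = x"
proof (rule limit_points_unique)
  show "limit_point (full_pattern x) \<in> limit_points (full_pattern x)"
  proof (rule limit_point_in)
    show "full_pattern x \<in> topspace L"
      using assms by (simp add: topspace_inverse_limit forget_last_pattern)
  qed
  have "x \<in> T closure_of realizing_points (full_pattern x) n" for n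
    using assms by (auto simp: in_closure_of realizing_points_def)
  then show "x \<in> limit_points (full_pattern x)"
    by (simp add: limit_points_def)
qed

text \<open>
  If \<open>U i\<close> contains the limit point of \<open>a\<close> and has closure inside \<open>V\<close>, then the single bit \<open>i\<close>
  already forces the limit point into \<open>V\<close>, and having that bit set is an open condition.
\<close>

lemma continuous_map_limit_point: "continuous_map L T limit_point"
  unfolding continuous_map_def
proof (intro conjI allI impI)
  show "limit_point \<in> topspace L \<rightarrow> topspace T"
    using limit_point_in limit_points_subset_topspace by blast
next
  fix V assume V: "openin T V"
  show "openin L {a \<in> topspace L. limit_point a \<in> V}"
  proof (subst openin_subopen, intro ballI)
    fix a assume a: "a \<in> {a \<in> topspace L. limit_point a \<in> V}"
    then have aL: "a \<in> topspace L" and "limit_point a \<in> V"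
      by auto
    from base_closure[OF V this(2)]
    obtain i where i: "limit_point a \<in> U i" "T closure_of U i \<subseteq> V" .
    let ?C = "{c \<in> pattern U (Suc i) ` topspace T. i \<in> set_decode c}"
    let ?N = "{b \<in> topspace L. b (Suc i) \<in> ?C}"
    have "openin (pattern_space T U (Suc i)) ?C"
      unfolding pattern_space_def openin_upset_topology by blast
    moreover have "continuous_map L (pattern_space T U (Suc i)) (\<lambda>b. b (Suc i))"
      unfolding inverse_limit_def
      by (intro continuous_map_from_subtopology continuous_map_product_projection) simp
    ultimately have "openin L ?N"
      by (rule openin_continuous_map_preimage[rotated])
    moreover have "a \<in> ?N"
    proof -
      have "i \<in> set_decode (a (Suc i))"
        using limit_point_bit[OF limit_point_in[OF aL] i(1)] by blast
      moreover have "a (Suc i) \<in> pattern U (Suc i) ` topspace T"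
        using aL by (simp add: topspace_inverse_limit)
      ultimately show ?thesis
        using aL by blast
    qed
    moreover have "?N \<subseteq> {a \<in> topspace L. limit_point a \<in> V}"
    proof
      fix b assume b: "b \<in> ?N"
      then have "limit_point b \<in> T closure_of U i"
        by (intro limit_points_in_closure[of _ b] limit_point_in) simp_all
      with b i(2) show "b \<in> {a \<in> topspace L. limit_point a \<in> V}"
        by blast
    qed
    ultimately show "\<exists>N. openin L N \<and> a \<in> N \<and> N \<subseteq> {a \<in> topspace L. limit_point a \<in> V}"
      by blast
  qed
qed

lemma homotopy_equivalent_space_limit: "L homotopy_equivalent_space T"
proof -
  have "homotopic_with (\<lambda>h. True) L L (full_pattern \<circ> limit_point) id"
  proof (rule homotopic_with_inverse_limit_specialization)
    show "continuous_map L L (full_pattern \<circ> limit_point)"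
      using continuous_map_limit_point continuous_map_full_pattern by (rule continuous_map_compose)
  next
    fix a n W
    assume a: "a \<in> topspace L" and W: "openin (pattern_space T U n) W"
      and "(full_pattern \<circ> limit_point) a n \<in> W"
    then have mem: "pattern U n (limit_point a) \<in> W"
      by simp
    have "set_decode (pattern U n (limit_point a)) \<subseteq> set_decode (a n)"
      unfolding set_decode_pattern using limit_point_bit[OF limit_point_in[OF a]] by blast
    moreover have "a n \<in> pattern U n ` topspace T"
      using a by (simp add: topspace_inverse_limit)
    ultimately have "a n \<in> W"
      using W mem unfolding pattern_space_def openin_upset_topology by blast
    then show "id a n \<in> W"
      by simp
  qed (rule continuous_map_id)
  moreover have "homotopic_with (\<lambda>h. True) T T (limit_point \<circ> full_pattern) id"
  proof (rule homotopic_with_equal)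
    show "continuous_map T T (limit_point \<circ> full_pattern)"
      using continuous_map_full_pattern continuous_map_limit_point by (rule continuous_map_compose)
  qed (simp_all add: limit_point_full_pattern)
  ultimately show ?thesis
    unfolding homotopy_equivalent_space_def
    using continuous_map_limit_point continuous_map_full_pattern
    by (intro exI[of _ limit_point] exI[of _ full_pattern] conjI)
qed

end

section \<open>Compact metric spaces\<close>

lemma (in Metric_space) compact_imp_second_countable:
  assumes "compact_space mtopology"
  shows "second_countable mtopology"
proof -
  have "mtotally_bounded M"
    using assms compact_space_eq_mcomplete_mtotally_bounded by blast
  then have "\<forall>k::nat. \<exists>K. finite K \<and> K \<subseteq> M \<and> M \<subseteq> (\<Union>x\<in>K. mball x (inverse (Suc k)))"
    unfolding mtotally_bounded_def by simp
  then obtain K where K: "\<And>k::nat. finite (K k)"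
      "\<And>k. M \<subseteq> (\<Union>x\<in>K k. mball x (inverse (Suc k)))"
    by metis
  let ?B = "\<Union>k. (\<lambda>x. mball x (inverse (Suc k))) ` K k"
  have "\<exists>V\<in>?B. x \<in> V \<and> V \<subseteq> W" if W: "openin mtopology W" "x \<in> W" for W x
  proof -
    obtain r where r: "r > 0" "mball x r \<subseteq> W" and x: "x \<in> M"
      using W unfolding openin_mtopology by blast
    obtain k where k: "inverse (Suc k) < r / 2"
      using reals_Archimedean[of "r / 2"] r by auto
    obtain c where c: "c \<in> K k" "x \<in> mball c (inverse (Suc k))"
      using K x by blast
    have "mball c (inverse (Suc k)) \<subseteq> mball x r"
    proof
      fix y assume y: "y \<in> mball c (inverse (Suc k))"
      then have "d x y \<le> d c x + d c y"
        using triangle[of x c y] commute[of c x] x c(2) by simp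
      with y c(2) k x show "y \<in> mball x r"
        by simp
    qed
    with r(2) have "mball c (inverse (Suc k)) \<subseteq> W"
      by (rule subset_trans[rotated])
    moreover have "mball c (inverse (Suc k)) \<in> ?B"
      using c(1) by (intro UN_I[of k] imageI) simp_all
    ultimately show ?thesis
      using c(2) by blast
  qed
  moreover have "countable ?B"
    by (rule countable_UN) (simp_all add: K(1) countable_finite)
  moreover have "openin mtopology V" if "V \<in> ?B" for V
    using that openin_mball by blast
  ultimately show ?thesis
    unfolding second_countable_def by (intro exI[of _ ?B] conjI) simp_all
qed

theorem corollary2:
  fixes M :: "'a set" and d :: "'a \<Rightarrow> 'a \<Rightarrow> real"
  assumes "Metric_space M d"
    and "compact_space (Metric_space.mtopology M d)"
  shows "\<exists>(X :: nat \<Rightarrow> nat topology) p.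
           (\<forall>n. finite (topspace (X n))) \<and>
           inverse_sequence X p \<and>
           inverse_limit X p homotopy_equivalent_space Metric_space.mtopology M d"
proof -
  interpret Metric_space M d by fact
  obtain B where B: "countable B" "\<And>V. V \<in> B \<Longrightarrow> openin mtopology V"
    and B_base: "\<And>W x. openin mtopology W \<Longrightarrow> x \<in> W \<Longrightarrow> \<exists>V\<in>B. x \<in> V \<and> V \<subseteq> W"
    using compact_imp_second_countable[OF assms(2)] unfolding second_countable_def by metis
  \<comment> \<open>The base of an empty space may be empty; the empty set is added so that there is something to
    enumerate.\<close>
  define U where "U = from_nat_into (insert {} B)"
  have range_U: "range U = insert {} B"
    unfolding U_def using B by (intro range_from_nat_into) auto
  interpret compact_Hausdorff_base mtopology U
  proof
    show "openin mtopology (U i)" for i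
    proof -
      have "U i \<in> insert {} B"
        using range_U by blast
      then show ?thesis
        using B(2) by auto
    qed
    show "\<exists>i. x \<in> U i \<and> U i \<subseteq> W" if W: "openin mtopology W" "x \<in> W" for W x
    proof -
      obtain V where "V \<in> B" "x \<in> V" "V \<subseteq> W"
        using B_base[OF W] by blast
      moreover from \<open>V \<in> B\<close> have "V \<in> range U"
        unfolding range_U by (rule insertI2)
      ultimately show ?thesis
        by blast
    qed
  qed (use assms(2) Hausdorff_space_mtopology in auto)
  have "finite (topspace (pattern_space mtopology U n))" for n
    using finite_range_pattern[of U n] by (auto elim: rev_finite_subset)
  then show ?thesis
    using inverse_sequence_pattern_space homotopy_equivalent_space_limit by blast
qed

end
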